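(* The sequential algorithm with the median-time scheduling policy is asymptotically $8/3$-approximate for the container delivery scheduling problem.
   Context: An instance $\langle \mathcal{I},B\rangle$ of the container delivery scheduling problem consists of a set $\mathcal{I}=\{1,\ldots,n\}$ of items, each item $i$ having a due time $d_i\in\mathbb{Z}^+$, and an inventory bound $B>0$. For a time $\tau\ge 0$ put $\delta_i(\tau)=|d_i-\tau|$. A feasible solution with $m$ bins is a partition of $\mathcal{I}$ into subsets (bins) $\mathcal{S}_1,\ldots,\mathcal{S}_m$ together with delivery times $\mu_1,\ldots,\mu_m\ge 0$ such that $\sum_{i\in\mathcal{S}_j}\delta_i(\mu_j)\le B$ for every $j$. An optimal solution is a feasible solution minimizing the number of bins; this minimum is denoted $\hat m$. An algorithm is asymptotically $\rho$-approximate if there is a constant $c$, independent of the instance, such that on every instance it returns a feasible solution with $m\le\rho\,\hat m+c$ bins. Sequential algorithm: number the items so that $d_1\le\ldots\le d_n$. Open an empty bin $j=1$. For $i=1,\ldots,n$ in this order: if the inventory cost of the set $\mathcal{S}_j\cup\{i\}$, when delivered in one bin at the time prescribed by the scheduling policy, exceeds $B$, then open a new empty bin and let $j$ be its index ($j\leftarrow j+1$); in either case, add $i$ to $\mathcal{S}_j$. At the end each bin is delivered at the time prescribed by the policy. Median-time scheduling policy: a set $\mathcal{S}_j$ of items packed in one bin is delivered at $\mu_j$ equal to the median of the due times $d_i$, $i\in\mathcal{S}_j$ (counted with multiplicity). *)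

theory Defs
  imports Complex_Main "HOL-Library.Multiset" "HOL-Library.Disjoint_Sets"
begin

record cds_instance =
  num_items :: nat
  due :: "nat \<Rightarrow> int"
  bound :: real

definition items :: "cds_instance \<Rightarrow> nat set" where
  "items I = {1..num_items I}"

definition valid_instance :: "cds_instance \<Rightarrow> bool" where
  "valid_instance I \<longleftrightarrow> num_items I \<ge> 1 \<and> (\<forall>i\<in>items I. due I i > 0) \<and> bound I > 0"

definition deviation :: "cds_instance \<Rightarrow> nat \<Rightarrow> real \<Rightarrow> real" where
  "deviation I i \<tau> = \<bar>real_of_int (due I i) - \<tau>\<bar>"

definition inventory_cost :: "cds_instance \<Rightarrow> nat set \<Rightarrow> real \<Rightarrow> real" where
  "inventory_cost I S \<mu> = (\<Sum>i\<in>S. deviation I i \<mu>)"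

text \<open>A solution lists its bins, each paired with its delivery time; its length is the
  number \<open>m\<close> of bins.\<close>
type_synonym solution = "(nat set \<times> real) list"

definition feasible :: "cds_instance \<Rightarrow> solution \<Rightarrow> bool" where
  "feasible I sol \<longleftrightarrow>
     distinct (map fst sol) \<and> partition_on (items I) (set (map fst sol)) \<and>
     (\<forall>(S, \<mu>)\<in>set sol. \<mu> \<ge> 0 \<and> inventory_cost I S \<mu> \<le> bound I)"

definition min_bins :: "cds_instance \<Rightarrow> nat" where
  "min_bins I = (LEAST m. \<exists>sol. feasible I sol \<and> length sol = m)"

text \<open>The minimum is attained: delivering every item in its own bin at its due time is feasible.\<close>
lemma feasible_exists:
  assumes "valid_instance I"
  shows "\<exists>sol. feasible I sol"
proof -
  let ?sol = "map (\<lambda>i. ({i}, real_of_int (due I i))) [1..<Suc (num_items I)]"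
  have fst: "map fst ?sol = map (\<lambda>i. {i}) [1..<Suc (num_items I)]"
    by (simp add: comp_def)
  have "distinct (map fst ?sol)"
    unfolding fst by (simp add: distinct_map del: upt_Suc)
  moreover have "partition_on (items I) (set (map fst ?sol))"
    unfolding fst by (auto simp: partition_on_def disjoint_def items_def)
  moreover have "\<forall>(S, \<mu>)\<in>set ?sol. \<mu> \<ge> 0 \<and> inventory_cost I S \<mu> \<le> bound I"
    using assms
    by (auto simp: valid_instance_def items_def inventory_cost_def deviation_def less_imp_le
             simp del: upt_Suc)
  ultimately show ?thesis
    unfolding feasible_def by blast
qed

text \<open>An algorithm is a relation between instances and the solutions it may return, because
  the sequential algorithm leaves the numbering of items with equal due times open. The
  guarantee is required of every possible output, and some output must exist.\<close>
definition asymptotically_approximate ::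
  "real \<Rightarrow> (cds_instance \<Rightarrow> solution \<Rightarrow> bool) \<Rightarrow> bool" where
  "asymptotically_approximate \<rho> alg \<longleftrightarrow>
     (\<exists>c::real. \<forall>I. valid_instance I \<longrightarrow>
        (\<exists>sol. alg I sol) \<and>
        (\<forall>sol. alg I sol \<longrightarrow>
           feasible I sol \<and> real (length sol) \<le> \<rho> * real (min_bins I) + c))"

text \<open>A scheduling policy prescribes the delivery time of a set of items packed in one bin.\<close>
type_synonym policy = "cds_instance \<Rightarrow> nat set \<Rightarrow> real"

text \<open>\<open>S\<close> is the currently open bin; the last argument lists the items still to be packed.\<close>
fun seq_bins :: "policy \<Rightarrow> cds_instance \<Rightarrow> nat set \<Rightarrow> nat list \<Rightarrow> nat set list" where
  "seq_bins p I S [] = [S]"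
| "seq_bins p I S (i # xs) =
     (if inventory_cost I (insert i S) (p I (insert i S)) > bound I
      then S # seq_bins p I {i} xs
      else seq_bins p I (insert i S) xs)"

definition sequential_algorithm :: "policy \<Rightarrow> cds_instance \<Rightarrow> solution \<Rightarrow> bool" where
  "sequential_algorithm p I sol \<longleftrightarrow>
     (\<exists>xs. distinct xs \<and> set xs = items I \<and> sorted (map (due I) xs) \<and>
           sol = map (\<lambda>S. (S, p I S)) (seq_bins p I {} xs))"

text \<open>For an even number of values, the median is the mean of the two middle ones. The value at
  the empty multiset is unspecified and never used: the policy is only applied to nonempty bins.\<close>
definition median :: "int multiset \<Rightarrow> real" where
  "median M =
     (let xs = sorted_list_of_multiset M; k = length xs in
      if odd k then real_of_int (xs ! (k div 2))
      else (real_of_int (xs ! (k div 2 - 1)) + real_of_int (xs ! (k div 2))) / 2)"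

definition median_policy :: policy where
  "median_policy I S = median (image_mset (due I) (mset_set S))"

end

theory Submission
  imports Defs
begin

text \<open>
  Send every item to a nearest delivery time of an optimal solution, which costs at most
  \<open>m B\<close> in total, where \<open>m\<close> is the optimal number of bins. Let a
  bin of the sequential algorithm be closed by the item \<open>y\<close>. If its items and \<open>y\<close> do not all
  go to the same delivery time, then a boundary between two nearest-point cells is crossed, which
  happens fewer than \<open>m\<close> times. Otherwise they go to a common \<open>c\<close> and together pay
  more than \<open>B\<close>, since the median minimises the cost. To make these payments disjoint, \<open>y\<close> is left
  out when it lies before \<open>c\<close>, and the first item of the bin when it lies after \<open>c\<close>: delivering
  at the omitted item's due time still costs more than \<open>B\<close>. Hence the algorithm is even
  2-approximate.
\<close>

subsection \<open>The median minimises the cost\<close>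

definition list_median :: "int list \<Rightarrow> real" where
  "list_median xs = (let k = length xs in
      if odd k then real_of_int (xs ! (k div 2))
      else (real_of_int (xs ! (k div 2 - 1)) + real_of_int (xs ! (k div 2))) / 2)"

lemma median_eq_list_median: "median M = list_median (sorted_list_of_multiset M)"
  by (simp add: median_def list_median_def Let_def)

text \<open>For odd length the median is the middle entry, for even length the mean of the two
  middle entries; indices \<open>i\<close> and \<open>length xs - 1 - i\<close> enclose all of
  these.\<close>

lemma list_median_between:
  assumes "sorted xs" "i \<le> length xs - 1 - i" "i < length xs"
  shows "real_of_int (xs ! i) \<le> list_median xs"
    and "list_median xs \<le> real_of_int (xs ! (length xs - 1 - i))"
proof -
  let ?k = "length xs"
  have mono: "xs ! a \<le> xs ! b" if "a \<le> b" "b < ?k" for a b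
    using sorted_nth_mono[OF assms(1)] that by blast
  have "real_of_int (xs ! i) \<le> list_median xs \<and>
        list_median xs \<le> real_of_int (xs ! (?k - 1 - i))"
  proof (cases "odd ?k")
    case True
    then obtain q where "?k = 2 * q + 1" by (rule oddE)
    then have "i \<le> ?k div 2" "?k div 2 \<le> ?k - 1 - i" "?k div 2 < ?k"
      using assms by simp_all
    then show ?thesis
      using True mono[of i "?k div 2"] mono[of "?k div 2" "?k - 1 - i"] assms
      by (simp add: list_median_def)
  next
    case False
    then obtain q where "?k = 2 * q" by (blast elim: evenE)
    then have "i \<le> ?k div 2 - 1" "i \<le> ?k div 2" "?k div 2 - 1 \<le> ?k - 1 - i"
        "?k div 2 \<le> ?k - 1 - i" "?k div 2 < ?k" "?k div 2 - 1 < ?k" "?k - 1 - i < ?k"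
      using assms by simp_all
    then have "xs ! i \<le> xs ! (?k div 2 - 1)" "xs ! i \<le> xs ! (?k div 2)"
        "xs ! (?k div 2 - 1) \<le> xs ! (?k - 1 - i)" "xs ! (?k div 2) \<le> xs ! (?k - 1 - i)"
      using mono by blast+
    then show ?thesis
      using False by (simp add: list_median_def Let_def)
  qed
  then show "real_of_int (xs ! i) \<le> list_median xs"
    and "list_median xs \<le> real_of_int (xs ! (?k - 1 - i))" by auto
qed

text \<open>The \<open>i\<close>-th smallest and \<open>i\<close>-th largest elements are at least their distance away from
  \<open>\<mu>\<close> in total, with equality at the median.\<close>
lemma list_median_minimises:
  assumes "sorted xs"
  shows "(\<Sum>x\<leftarrow>xs. \<bar>real_of_int x - list_median xs\<bar>) \<le> (\<Sum>x\<leftarrow>xs. \<bar>real_of_int x - \<mu>\<bar>)"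
proof -
  let ?k = "length xs"
  let ?r = "\<lambda>i. ?k - 1 - i"
  \<comment> \<open>Doubling lets every index be paired with its mirror image; the middle index of
    an odd list is paired with itself.\<close>
  have double: "2 * (\<Sum>x\<leftarrow>xs. f x) = (\<Sum>i<?k. f (xs ! i) + f (xs ! ?r i))"
    for f :: "int \<Rightarrow> real"
  proof -
    have "(\<Sum>x\<leftarrow>xs. f x) = (\<Sum>i<?k. f (xs ! i))"
      by (simp add: sum_list_sum_nth atLeast0LessThan)
    moreover have "(\<Sum>i<?k. f (xs ! ?r i)) = (\<Sum>i<?k. f (xs ! i))"
      using sum.nat_diff_reindex[of "\<lambda>i. f (xs ! i)" ?k] by simp
    ultimately show ?thesis
      by (simp add: sum.distrib)
  qed
  have pair: "\<bar>real_of_int (xs ! i) - list_median xs\<bar> + \<bar>real_of_int (xs ! ?r i) - list_median xs\<bar>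
      \<le> \<bar>real_of_int (xs ! i) - \<mu>\<bar> + \<bar>real_of_int (xs ! ?r i) - \<mu>\<bar>" if "i < ?k" for i
  proof (cases "i \<le> ?r i")
    case True
    then show ?thesis
      using list_median_between[OF assms True that] by linarith
  next
    case False
    then have "?r i \<le> ?r (?r i)" "?r i < ?k" "?r (?r i) = i"
      using that by linarith+
    then show ?thesis
      using list_median_between[OF assms, of "?r i"] by simp
  qed
  have "2 * (\<Sum>x\<leftarrow>xs. \<bar>real_of_int x - list_median xs\<bar>) \<le> 2 * (\<Sum>x\<leftarrow>xs. \<bar>real_of_int x - \<mu>\<bar>)"
    unfolding double by (rule sum_mono) (use pair in auto)
  then show ?thesis by simp
qed

text \<open>Carries the list argument over to bins. For infinite \<open>S\<close> both sides are
  0.\<close>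

lemma inventory_cost_sum_list:
  "inventory_cost I S \<mu> = (\<Sum>x\<leftarrow>sorted_list_of_multiset (image_mset (due I) (mset_set S)).
      \<bar>real_of_int x - \<mu>\<bar>)"
proof -
  let ?xs = "sorted_list_of_multiset (image_mset (due I) (mset_set S))"
  have "(\<Sum>x\<leftarrow>?xs. \<bar>real_of_int x - \<mu>\<bar>) = sum_mset (image_mset (\<lambda>x. \<bar>real_of_int x - \<mu>\<bar>) (mset ?xs))"
    by (metis mset_map sum_mset_sum_list)
  also have "\<dots> = inventory_cost I S \<mu>"
    by (simp add: inventory_cost_def deviation_def sum_unfold_sum_mset multiset.map_comp comp_def)
  finally show ?thesis by simp
qed

lemma median_policy_minimises:
  "inventory_cost I S (median_policy I S) \<le> inventory_cost I S \<mu>"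
  unfolding inventory_cost_sum_list median_policy_def median_eq_list_median
  by (rule list_median_minimises) simp

lemma median_policy_nonneg:
  assumes "finite S" "S \<noteq> {}" "\<forall>i\<in>S. due I i > 0"
  shows "median_policy I S \<ge> 0"
proof -
  define xs where "xs = sorted_list_of_multiset (image_mset (due I) (mset_set S))"
  have set: "set xs = due I ` S"
    using assms(1) by (simp add: xs_def)
  then have "xs \<noteq> []" using assms(2) by auto
  then have "xs ! 0 \<in> set xs" "0 < length xs" by auto
  then have "0 < xs ! 0" using set assms(3) by auto
  moreover have "real_of_int (xs ! 0) \<le> list_median xs"
    using \<open>xs \<noteq> []\<close> by (intro list_median_between(1)) (auto simp: xs_def)
  ultimately show ?thesis
    unfolding median_policy_def median_eq_list_median xs_def[symmetric] by linarith
qed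

subsection \<open>Nearest points\<close>

text \<open>\<open>Min\<close> sends ties to the left, which makes \<open>nearest_less\<close>
  strict.\<close>

definition nearest :: "real set \<Rightarrow> real \<Rightarrow> real" where
  "nearest C x = Min {c \<in> C. \<forall>c'\<in>C. \<bar>x - c\<bar> \<le> \<bar>x - c'\<bar>}"

lemma nearest:
  assumes "finite C" "C \<noteq> {}"
  shows nearest_in: "nearest C x \<in> C"
    and nearest_le: "c \<in> C \<Longrightarrow> \<bar>x - nearest C x\<bar> \<le> \<bar>x - c\<bar>"
    and nearest_less: "c \<in> C \<Longrightarrow> c < nearest C x \<Longrightarrow> \<bar>x - nearest C x\<bar> < \<bar>x - c\<bar>"
proof -
  let ?N = "{c \<in> C. \<forall>c'\<in>C. \<bar>x - c\<bar> \<le> \<bar>x - c'\<bar>}"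
  have fin: "finite ?N" using assms by simp
  obtain c0 where "c0 \<in> C" "\<forall>c'\<in>C. \<bar>x - c0\<bar> \<le> \<bar>x - c'\<bar>"
    using ex_is_arg_min_if_finite[OF assms, of "\<lambda>c. \<bar>x - c\<bar>"]
    by (auto simp: is_arg_min_linorder)
  then have "?N \<noteq> {}" by blast
  then have N: "nearest C x \<in> ?N"
    unfolding nearest_def using Min_in[OF fin] by blast
  then show "nearest C x \<in> C" by simp
  show le: "\<bar>x - nearest C x\<bar> \<le> \<bar>x - c\<bar>" if "c \<in> C" for c
    using N that by simp
  show "\<bar>x - nearest C x\<bar> < \<bar>x - c\<bar>" if "c \<in> C" "c < nearest C x" for c
  proof (rule ccontr)
    assume "\<not> ?thesis"
    then have "c \<in> ?N" using that(1) N by force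
    then show False using Min_le[OF fin] that(2) unfolding nearest_def by fastforce
  qed
qed

text \<open>If the images were reversed, \<open>x\<close> would lie strictly right of their midpoint
  and \<open>y\<close> would not, against \<open>x \<le> y\<close>.\<close>

lemma nearest_mono:
  assumes "finite C" "C \<noteq> {}" "x \<le> y"
  shows "nearest C x \<le> nearest C y"
proof (rule ccontr)
  assume "\<not> ?thesis"
  then have less: "nearest C y < nearest C x" by simp
  have "\<bar>x - nearest C x\<bar> < \<bar>x - nearest C y\<bar>"
    by (rule nearest_less[OF assms(1,2) nearest_in[OF assms(1,2)] less])
  moreover have "\<bar>y - nearest C y\<bar> \<le> \<bar>y - nearest C x\<bar>"
    by (rule nearest_le[OF assms(1,2) nearest_in[OF assms(1,2)]])
  ultimately show False using less assms(3) by linarith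
qed

subsection \<open>The sequential algorithm\<close>

lemma Union_seq_bins: "\<Union> (set (seq_bins p I S xs)) = S \<union> set xs"
  by (induction p I S xs rule: seq_bins.induct) auto

text \<open>The open bin must be nonempty because a partition has no empty class.\<close>

lemma seq_bins_partition:
  assumes "S \<noteq> {}" "distinct xs" "S \<inter> set xs = {}"
  shows "distinct (seq_bins p I S xs) \<and> partition_on (S \<union> set xs) (set (seq_bins p I S xs))"
  using assms
proof (induction p I S xs rule: seq_bins.induct)
  case (1 p I S)
  then show ?case by (simp add: partition_on_def)
next
  case (2 p I S i xs)
  show ?case
  proof (cases "inventory_cost I (insert i S) (p I (insert i S)) > bound I")
    case True
    have IH: "distinct (seq_bins p I {i} xs) \<and>
        partition_on ({i} \<union> set xs) (set (seq_bins p I {i} xs))"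
      using 2 True by (intro 2(1)) auto
    have disj: "disjnt S B" if "B \<in> set (seq_bins p I {i} xs)" for B
      using that Union_seq_bins[of p I "{i}" xs] 2(5) by (auto simp: disjnt_def)
    have "S \<notin> set (seq_bins p I {i} xs)"
      using disj[of S] 2(3) by (auto simp: disjnt_def)
    then show ?thesis
      using True IH disj 2(3)
      by (auto simp: partition_on_def disjoint_def disjnt_def)
  next
    case False
    have "distinct (seq_bins p I (insert i S) xs) \<and>
        partition_on (insert i S \<union> set xs) (set (seq_bins p I (insert i S) xs))"
      using 2 False by (intro 2(2)) auto
    then show ?thesis using False by simp
  qed
qed

lemma seq_bins_cost:
  assumes "\<And>i. inventory_cost I {i} (p I {i}) \<le> bound I"
    and "inventory_cost I S (p I S) \<le> bound I"
    and "B \<in> set (seq_bins p I S xs)"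
  shows "inventory_cost I B (p I B) \<le> bound I"
  using assms by (induction p I S xs rule: seq_bins.induct) (auto split: if_splits)

text \<open>\<open>f\<close> is a first item of the open bin \<open>S\<close>. If it lies after its nearest point, its payment has
  been used up by the preceding bin, hence the subtracted maximum. The cardinality counts the
  cells that can still be entered.\<close>
lemma seq_bins_length:
  fixes I :: cds_instance and C :: "real set"
  defines "d \<equiv> \<lambda>i. real_of_int (due I i)"
  defines "w \<equiv> \<lambda>i. \<bar>d i - nearest C (d i)\<bar>"
  assumes p: "\<And>S \<mu>. inventory_cost I S (p I S) \<le> inventory_cost I S \<mu>"
    and C: "finite C" "C \<noteq> {}" and B: "bound I > 0"
    and "finite S" "f \<in> S" "\<forall>i\<in>S. d f \<le> d i" "\<forall>i\<in>S. \<forall>j\<in>set xs. d i \<le> d j"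
    and "S \<inter> set xs = {}" "distinct xs" "sorted (map (due I) xs)"
  shows "bound I * (real (length (seq_bins p I S xs)) - 1)
     \<le> sum w (S \<union> set xs) - max 0 (d f - nearest C (d f))
       + bound I * real (card {c \<in> C. c > nearest C (d f)})"
  using assms(7-)
proof (induction xs arbitrary: S f)
  case Nil
  have "w f \<le> sum w S"
    using Nil by (intro member_le_sum) (auto simp: w_def)
  then have "0 \<le> sum w S - max 0 (d f - nearest C (d f))"
    unfolding w_def by linarith
  then show ?case using B by simp
next
  case (Cons y xs)
  let ?n = "\<lambda>i. nearest C (d i)"
  let ?X = "S \<union> set (y # xs)"
  have fy: "d f \<le> d y" and yS: "y \<notin> S" using Cons.prems by auto
  have sum_split: "sum w ?X = sum w S + sum w (insert y (set xs))"
    using Cons.prems by (subst sum.union_disjoint[symmetric]) auto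
  show ?case
  proof (cases "inventory_cost I (insert y S) (p I (insert y S)) > bound I")
    case False
    have "bound I * (real (length (seq_bins p I (insert y S) xs)) - 1)
     \<le> sum w (insert y S \<union> set xs) - max 0 (d f - ?n f)
       + bound I * real (card {c \<in> C. c > ?n f})"
      using Cons.prems by (intro Cons.IH) (auto simp: d_def)
    then show ?thesis using False by simp
  next
    case True
    let ?L = "length (seq_bins p I {y} xs)"
    let ?k = "\<lambda>i. real (card {c \<in> C. c > ?n i})"
    have IH: "bound I * (real ?L - 1)
     \<le> sum w ({y} \<union> set xs) - max 0 (d y - ?n y) + bound I * ?k y"
      using Cons.prems by (intro Cons.IH) (auto simp: d_def)
    have cost: "bound I < (\<Sum>i\<in>insert y S. \<bar>d i - \<mu>\<bar>)" for \<mu>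
      using True p[of "insert y S" \<mu>]
      by (auto simp: inventory_cost_def deviation_def d_def)
    have cost': "bound I < \<bar>d y - \<mu>\<bar> + (\<Sum>i\<in>S. \<bar>d i - \<mu>\<bar>)" for \<mu>
      using cost[of \<mu>] Cons.prems yS by simp
    have ny: "?n f \<le> ?n y" by (rule nearest_mono[OF C fy])
    have wf: "w f \<le> sum w S"
      using Cons.prems by (intro member_le_sum) (auto simp: w_def)
    \<comment> \<open>What closing \<open>S\<close> must contribute to turn \<open>IH\<close> into
      the claim. The maximum for \<open>y\<close> appears with a plus sign: this bin claims the
      payment that \<open>IH\<close> has set aside.\<close>
    have step: "bound I \<le> sum w S - max 0 (d f - ?n f) + max 0 (d y - ?n y)
        + bound I * (?k f - ?k y)"
    proof (cases "?n f = ?n y")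
      case False
      then have less: "?n f < ?n y" using ny by simp
      \<comment> \<open>The point \<open>?n y\<close> is counted for \<open>f\<close> but no longer
        for \<open>y\<close>, so the drop in the count alone yields \<open>bound I\<close>.\<close>
      have "{c \<in> C. c > ?n y} \<subset> {c \<in> C. c > ?n f}"
        using less nearest_in[OF C, of "d y"] by auto
      then have "card {c \<in> C. c > ?n y} < card {c \<in> C. c > ?n f}"
        using C by (intro psubset_card_mono) auto
      then have "1 \<le> ?k f - ?k y" by linarith
      then have "bound I \<le> bound I * (?k f - ?k y)" using B by simp
      moreover have "0 \<le> sum w S - max 0 (d f - ?n f)" using wf unfolding w_def by linarith
      ultimately show ?thesis by linarith
    next
      case eq: True
      define c where "c = ?n f"
      have nS: "?n i = c" if "i \<in> S" for i
      proof -
        have "d f \<le> d i" "d i \<le> d y" using that Cons.prems by auto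
        then have "?n f \<le> ?n i" "?n i \<le> ?n y" using nearest_mono[OF C] by auto
        then show ?thesis using eq c_def by simp
      qed
      have wS: "sum w S = (\<Sum>i\<in>S. \<bar>d i - c\<bar>)"
        using nS by (intro sum.cong) (auto simp: w_def)
      have "bound I \<le> sum w S - max 0 (d f - c) + max 0 (d y - c)"
      proof -
        consider "d y \<le> c" | "d f \<ge> c" | "d f < c" "c < d y" by linarith
        then show ?thesis
        proof cases
          case 1
          \<comment> \<open>Delivery at \<open>d y\<close> costs nothing for \<open>y\<close>, and
            no item of \<open>S\<close> is farther from \<open>d y\<close> than from
            \<open>c\<close>, as \<open>d i \<le> d y \<le> c\<close>.\<close>
          have "(\<Sum>i\<in>S. \<bar>d i - d y\<bar>) \<le> sum w S"
            unfolding wS using 1 Cons.prems by (intro sum_mono) auto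
          then show ?thesis using cost'[of "d y"] 1 fy by simp
        next
          case 2
          \<comment> \<open>Delivery at \<open>d f\<close> costs nothing for \<open>f\<close>, whose
            payment is subtracted; since \<open>c \<le> d f\<close>, the other items and
            \<open>y\<close> are no farther from \<open>d f\<close> than from
            \<open>c\<close>.\<close>
          have "(\<Sum>i\<in>S - {f}. \<bar>d i - d f\<bar>) \<le> (\<Sum>i\<in>S - {f}. \<bar>d i - c\<bar>)"
            using 2 Cons.prems by (intro sum_mono) auto
          moreover have "(\<Sum>i\<in>S. g i) = g f + (\<Sum>i\<in>S - {f}. g i)" for g :: "nat \<Rightarrow> real"
            using Cons.prems by (simp add: sum.remove)
          ultimately show ?thesis using cost'[of "d f"] 2 fy unfolding wS by simp
        next
          case 3
          then show ?thesis using cost'[of c] unfolding wS by simp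
        qed
      qed
      then show ?thesis using eq c_def by simp
    qed
    have "bound I * (real (length (seq_bins p I S (y # xs))) - 1) = bound I * (real ?L - 1) + bound I"
      using True by (simp add: algebra_simps)
    also have "\<dots> \<le> sum w ?X - max 0 (d f - ?n f) + bound I * ?k f"
      using IH step sum_split by (simp add: algebra_simps)
    finally show ?thesis .
  qed
qed

section \<open>Comparison with an optimal solution\<close>

text \<open>The delivery time of an item's own bin is one of the candidate points, so passing to the
  nearest one cannot raise the cost of any bin above \<open>bound I\<close>.\<close>

lemma feasible_nearest_cost:
  assumes "feasible I sol" "bound I > 0" "finite (items I)" "items I \<noteq> {}"
  shows "(\<Sum>i\<in>items I. \<bar>real_of_int (due I i) - nearest (snd ` set sol) (real_of_int (due I i))\<bar>)
      \<le> bound I * real (length sol)"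
proof -
  let ?C = "snd ` set sol"
  let ?w = "\<lambda>i. \<bar>real_of_int (due I i) - nearest ?C (real_of_int (due I i))\<bar>"
  have part: "partition_on (items I) (set (map fst sol))" and dist: "distinct (map fst sol)"
    using assms(1) by (auto simp: feasible_def)
  have un: "\<Union> (set (map fst sol)) = items I"
    using part by (simp add: partition_on_def)
  have "sol \<noteq> []" using un assms(4) by auto
  then have C: "finite ?C" "?C \<noteq> {}" by auto
  have bin: "sum ?w S \<le> bound I" if S: "S \<in> set (map fst sol)" for S
  proof -
    obtain \<mu> where mu: "(S, \<mu>) \<in> set sol" using S by auto
    then have "\<mu> \<in> ?C" by force
    then have "sum ?w S \<le> inventory_cost I S \<mu>"
      unfolding inventory_cost_def deviation_def
      by (intro sum_mono nearest_le[OF C])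
    then show ?thesis using mu assms(1) by (auto simp: feasible_def)
  qed
  have "sum ?w (items I) = (\<Sum>S\<in>set (map fst sol). sum ?w S)"
    unfolding un[symmetric]
  proof (subst sum.Union_disjoint)
    show "\<forall>A\<in>set (map fst sol). finite A"
      using un assms(3) by (metis Union_upper finite_subset)
    show "\<forall>A\<in>set (map fst sol). \<forall>B\<in>set (map fst sol). A \<noteq> B \<longrightarrow> A \<inter> B = {}"
      using part by (auto simp: partition_on_def disjoint_def)
  qed simp
  also have "\<dots> \<le> real (card (set (map fst sol))) * bound I"
    by (rule sum_bounded_above) (rule bin)
  also have "\<dots> = bound I * real (length sol)"
    using distinct_card[OF dist] by simp
  finally show ?thesis .
qed

text \<open>The median enters only through \<open>p\<close> and \<open>p0\<close>: the policy
  minimises the cost of every bin and never prescribes a negative time.\<close>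

lemma sequential_algorithm_two_approximate:
  assumes I: "valid_instance I"
    and p: "\<And>S \<mu>. inventory_cost I S (p I S) \<le> inventory_cost I S \<mu>"
    and p0: "\<And>S. S \<noteq> {} \<Longrightarrow> S \<subseteq> items I \<Longrightarrow> p I S \<ge> 0"
    and alg: "sequential_algorithm p I sol"
  shows "feasible I sol" "length sol \<le> 2 * min_bins I"
proof -
  have fin: "finite (items I)" and ne: "items I \<noteq> {}" and B: "bound I > 0"
    using I by (auto simp: items_def valid_instance_def)
  obtain ys where ys: "distinct ys" "set ys = items I" "sorted (map (due I) ys)"
      "sol = map (\<lambda>S. (S, p I S)) (seq_bins p I {} ys)"
    using alg by (auto simp: sequential_algorithm_def)
  obtain x xs where ysx: "ys = x # xs" using ys(2) ne by (cases ys) auto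
  have single: "inventory_cost I {i} (p I {i}) \<le> bound I" for i
    using p[of "{i}" "real_of_int (due I i)"] B
    by (simp add: inventory_cost_def deviation_def)
  let ?b = "seq_bins p I {x} xs"
  \<comment> \<open>A single item fits by \<open>single\<close>, so the initial empty bin is never
    closed and the run continues from \<open>{x}\<close>.\<close>
  have sol: "sol = map (\<lambda>S. (S, p I S)) ?b"
    using ys(4) single[of x] ysx by simp
  have fsts: "map fst sol = ?b" unfolding sol by (simp add: comp_def)
  have items: "items I = {x} \<union> set xs" using ys(2) ysx by simp
  have part: "distinct ?b \<and> partition_on (items I) (set ?b)"
    unfolding items using ys(1) ysx by (intro seq_bins_partition) auto
  then have "S \<noteq> {}" "S \<subseteq> items I" if "S \<in> set ?b" for S
    using that by (auto simp: partition_on_def)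
  then show "feasible I sol"
    using part p0 seq_bins_cost[of I p, OF single single[of x]]
    unfolding feasible_def fsts by (auto simp: sol)
  obtain opt where opt: "feasible I opt" "length opt = min_bins I"
    using LeastI_ex[of "\<lambda>m. \<exists>sol. feasible I sol \<and> length sol = m"] feasible_exists[OF I]
    unfolding min_bins_def by blast
  let ?C = "snd ` set opt"
  let ?d = "\<lambda>i. real_of_int (due I i)"
  have "\<Union> (set (map fst opt)) = items I"
    using opt(1) by (simp add: feasible_def partition_on_def)
  then have "opt \<noteq> []" using ne by auto
  then have C: "finite ?C" "?C \<noteq> {}" by auto
  \<comment> \<open>The nearest point of \<open>x\<close> is not beyond itself, which saves one
    cell. Bins may share a delivery time, so \<open>card ?C\<close> is only bounded by the number of
    bins.\<close>
  have "card {c \<in> ?C. c > nearest ?C (?d x)} < card ?C"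
    using nearest_in[OF C, of "?d x"] C by (intro psubset_card_mono) auto
  also have "card ?C \<le> length opt"
    by (metis card_image_le card_length le_trans List.finite_set)
  finally have card: "real (card {c \<in> ?C. c > nearest ?C (?d x)}) \<le> real (min_bins I) - 1"
    using opt(2) by linarith
  have "bound I * (real (length ?b) - 1)
     \<le> (\<Sum>i\<in>{x} \<union> set xs. \<bar>?d i - nearest ?C (?d i)\<bar>) - max 0 (?d x - nearest ?C (?d x))
       + bound I * real (card {c \<in> ?C. c > nearest ?C (?d x)})"
    using ys(1,3) ysx by (intro seq_bins_length p C B) auto
  \<comment> \<open>All payments together give the first summand, the remaining cells the second;
    the subtracted maximum is dropped.\<close>
  also have "\<dots> \<le> bound I * real (min_bins I) + bound I * (real (min_bins I) - 1)"
    using feasible_nearest_cost[OF opt(1) B fin ne] card B opt(2)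
    unfolding items by (intro add_mono mult_left_mono) auto
  also have "\<dots> = bound I * (2 * real (min_bins I) - 1)"
    by (simp add: algebra_simps)
  finally have "real (length ?b) \<le> 2 * real (min_bins I)" using B by simp
  then show "length sol \<le> 2 * min_bins I" by (simp add: sol)
qed

theorem theorem10:
  "asymptotically_approximate (8 / 3) (sequential_algorithm median_policy)"
  unfolding asymptotically_approximate_def
\<comment> \<open>The additive constant can be 0, since the factor 2 is below 8/3.\<close>
proof (intro exI[of _ 0] allI impI conjI)
  fix I assume I: "valid_instance I"
  let ?xs = "sort_key (due I) [1..<Suc (num_items I)]"
  have "distinct ?xs" "set ?xs = items I" "sorted (map (due I) ?xs)"
    by (auto simp: items_def simp del: upt_Suc)
  then show "\<exists>sol. sequential_algorithm median_policy I sol"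
    unfolding sequential_algorithm_def by blast
next
  fix I sol assume I: "valid_instance I" and alg: "sequential_algorithm median_policy I sol"
  have nonneg: "median_policy I S \<ge> 0" if "S \<noteq> {}" "S \<subseteq> items I" for S
    using that I finite_subset[OF that(2)]
    by (intro median_policy_nonneg) (auto simp: items_def valid_instance_def)
  note two = sequential_algorithm_two_approximate[OF I median_policy_minimises nonneg alg]
  show "feasible I sol" by (rule two)
  show "real (length sol) \<le> 8 / 3 * real (min_bins I) + 0"
    using two(2) by linarith
qed

end
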